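(* Let $L/K$ be an unramified quadratic extension, $n\ge1$ and $0\le d<n$. For $u_1,u_2\in\mathcal{O}_{n-d}^*$, the lattices $u_1\mathcal{O}_n$ and $u_2\mathcal{O}_n$ represent the same vertex of the Bruhat–Tits tree of $SL(2,K)$ (i.e. are homothetic by an element of $K^*$) if and only if $u_1u_2^{-1}\in\mathcal{O}_n^*$. In particular, if $u_1,\dots,u_l$ is a set of representatives of $\mathcal{O}_{n-d}^*/\mathcal{O}_n^*$, then $u_1\mathcal{O}_n,\dots,u_l\mathcal{O}_n$ represent pairwise distinct vertices.
   Context: $K$ is a nonarchimedean local field of characteristic zero with ring of integers $\mathcal{O}_K$ and uniformizer $p$; $\mathcal{O}_L=\mathcal{O}_K[\Delta]$ is the ring of integers of $L$ (e.g. $\Delta=\sqrt{\epsilon}$ with $\epsilon$ a nonsquare unit of $\mathcal{O}_K$), and $\mathcal{O}_n=\mathcal{O}_K[p^n\Delta]$, with unit group $\mathcal{O}_n^*$. Vertices of the tree are $K^*$-homothety classes of $\mathcal{O}_K$-lattices in $L$. *)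

theory Defs
  imports
    Complex_Main
    "HOL-Library.Set_Algebras"
    "HOL-Computational_Algebra.Polynomial"
begin

text \<open>
  A valuation is a function \<open>v :: 'a \<Rightarrow> int\<close> of which only the values at nonzero arguments matter;
  the predicates below treat \<open>0\<close> as having valuation \<open>\<infinity>\<close>.
\<close>

definition val_ge :: "('a::field \<Rightarrow> int) \<Rightarrow> int \<Rightarrow> 'a \<Rightarrow> bool" where
  "val_ge v N x \<longleftrightarrow> x = 0 \<or> N \<le> v x"

definition val_ring :: "('a::field \<Rightarrow> int) \<Rightarrow> 'a set" where
  "val_ring v = {x. val_ge v 0 x}"

definition val_ideal :: "('a::field \<Rightarrow> int) \<Rightarrow> 'a set" where
  "val_ideal v = {x. val_ge v 1 x}"

definition uniformizer :: "('a::field \<Rightarrow> int) \<Rightarrow> 'a \<Rightarrow> bool" where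
  "uniformizer v p \<longleftrightarrow> p \<noteq> 0 \<and> v p = 1"

definition val_Cauchy :: "('a::field \<Rightarrow> int) \<Rightarrow> (nat \<Rightarrow> 'a) \<Rightarrow> bool" where
  "val_Cauchy v X \<longleftrightarrow> (\<forall>N. \<exists>M. \<forall>i\<ge>M. \<forall>j\<ge>M. val_ge v N (X i - X j))"

definition val_tendsto :: "('a::field \<Rightarrow> int) \<Rightarrow> (nat \<Rightarrow> 'a) \<Rightarrow> 'a \<Rightarrow> bool" where
  "val_tendsto v X l \<longleftrightarrow> (\<forall>N. \<exists>M. \<forall>i\<ge>M. val_ge v N (X i - l))"

text \<open>
  A nonarchimedean local field of characteristic zero: complete with respect to a normalized
  discrete valuation, with finite residue field.
\<close>

locale nonarch_local_field =
  fixes v :: "'a::field_char_0 \<Rightarrow> int"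
  assumes val_mult: "x \<noteq> 0 \<Longrightarrow> y \<noteq> 0 \<Longrightarrow> v (x * y) = v x + v y"
    and val_add: "x \<noteq> 0 \<Longrightarrow> y \<noteq> 0 \<Longrightarrow> x + y \<noteq> 0 \<Longrightarrow> min (v x) (v y) \<le> v (x + y)"
    and ex_uniformizer: "\<exists>p. uniformizer v p"
    and complete: "val_Cauchy v X \<Longrightarrow> \<exists>l. val_tendsto v X l"
    and finite_residue: "finite ((\<lambda>x. x +o val_ideal v) ` val_ring v)"

text \<open>
  An extension of local fields, given by an embedding of \<open>'k\<close> into \<open>'l\<close>. Both valuations
  are normalized, so the one on \<open>'l\<close> restricts to a multiple of the one on \<open>'k\<close>.
\<close>

locale local_field_extension =
  K: nonarch_local_field v + L: nonarch_local_field w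
  for v :: "'k::field_char_0 \<Rightarrow> int" and w :: "'l::field_char_0 \<Rightarrow> int" +
  fixes emb :: "'k \<Rightarrow> 'l"
  assumes emb_add: "emb (x + y) = emb x + emb y"
    and emb_mult: "emb (x * y) = emb x * emb y"
    and emb_one: "emb 1 = 1"
    and val_extends: "\<exists>e>0. \<forall>x. x \<noteq> 0 \<longrightarrow> w (emb x) = e * v x"

definition ramification_index ::
  "('k::field \<Rightarrow> int) \<Rightarrow> ('l::field \<Rightarrow> int) \<Rightarrow> ('k \<Rightarrow> 'l) \<Rightarrow> int" where
  "ramification_index v w emb = (THE e. \<forall>x. x \<noteq> 0 \<longrightarrow> w (emb x) = e * v x)"

abbreviation emb_scale :: "('k::field \<Rightarrow> 'l::field) \<Rightarrow> 'k \<Rightarrow> 'l \<Rightarrow> 'l" where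
  "emb_scale emb \<equiv> (\<lambda>a x. emb a * x)"

text \<open>
  The residue fields are finite, so the residue extension is separable and unramified means
  ramification index one. The library's dimension is \<open>0\<close> for infinite-dimensional
  spaces, so the value \<open>2\<close> includes finiteness.
\<close>

locale unramified_quadratic_extension = local_field_extension v w emb
  for v :: "'k::field_char_0 \<Rightarrow> int" and w :: "'l::field_char_0 \<Rightarrow> int" and emb :: "'k \<Rightarrow> 'l" +
  assumes degree_two: "vector_space.dim (emb_scale emb) (UNIV :: 'l set) = 2"
    and unramified: "ramification_index v w emb = 1"

definition adjoin :: "'a::comm_ring_1 set \<Rightarrow> 'a \<Rightarrow> 'a set" where
  "adjoin R x = {poly f x | f. \<forall>i. coeff f i \<in> R}"

definition quad_order ::
  "('k::field \<Rightarrow> int) \<Rightarrow> ('k \<Rightarrow> 'l::field) \<Rightarrow> 'k \<Rightarrow> 'l \<Rightarrow> nat \<Rightarrow> 'l set" where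
  "quad_order v emb p \<Delta> n = adjoin (emb ` val_ring v) (emb p ^ n * \<Delta>)"

definition ring_units :: "'a::comm_ring_1 set \<Rightarrow> 'a set" where
  "ring_units R = {x \<in> R. \<exists>y\<in>R. x * y = 1}"

definition coset_reps :: "'a::comm_ring_1 set \<Rightarrow> 'a set \<Rightarrow> nat \<Rightarrow> (nat \<Rightarrow> 'a) \<Rightarrow> bool" where
  "coset_reps G H l u \<longleftrightarrow>
     (\<forall>i\<in>{1..l}. u i \<in> G) \<and> bij_betw (\<lambda>i. u i *o H) {1..l} ((\<lambda>x. x *o H) ` G)"

text \<open>
  Lattices in \<open>'l\<close> are the finitely generated modules over the valuation ring that span
  \<open>'l\<close> over the base field.
\<close>

definition lattices :: "('k::field \<Rightarrow> int) \<Rightarrow> ('k \<Rightarrow> 'l::field) \<Rightarrow> 'l set set" where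
  "lattices v emb = {M. \<exists>B. finite B \<and>
     M = {\<Sum>b\<in>B. emb (c b) * b | c. \<forall>b\<in>B. c b \<in> val_ring v} \<and>
     module.span (emb_scale emb) M = UNIV}"

definition homothety :: "('k::field \<Rightarrow> int) \<Rightarrow> ('k \<Rightarrow> 'l::field) \<Rightarrow> ('l set \<times> 'l set) set" where
  "homothety v emb = {(M, N). M \<in> lattices v emb \<and> N \<in> lattices v emb \<and>
     (\<exists>c. c \<noteq> 0 \<and> N = emb c *o M)}"

definition tree_vertices :: "('k::field \<Rightarrow> int) \<Rightarrow> ('k \<Rightarrow> 'l::field) \<Rightarrow> 'l set set set" where
  "tree_vertices v emb = lattices v emb // homothety v emb"

definition vertex_of :: "('k::field \<Rightarrow> int) \<Rightarrow> ('k \<Rightarrow> 'l::field) \<Rightarrow> 'l set \<Rightarrow> 'l set set" where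
  "vertex_of v emb M = homothety v emb `` {M}"

end

theory Submission
  imports Defs
begin

text \<open>
  Write \<open>R\<close> for the valuation ring of \<open>K\<close>. The key point is that the valuation ring of \<open>L\<close> is
  the free module \<open>R \<oplus> R\<Delta>\<close>. Otherwise some \<open>a + b\<Delta>\<close> with \<open>b \<notin> R\<close> is integral, and dividing
  by \<open>b\<close> shows that \<open>\<Delta>\<close> is congruent to an element of \<open>R\<close> modulo the maximal ideal; since \<open>p\<close>
  is a uniformizer of \<open>L\<close> too, \<open>\<Delta>\<close> is then a limit of elements of \<open>R\<close>, so it lies in \<open>K\<close> by
  completeness and \<open>L = K\<close>. Consequently the order of level \<open>m\<close> is \<open>R \<oplus> p^m R\<Delta>\<close>. If
  \<open>u\<^sub>2\<O> = c u\<^sub>1\<O>\<close> for such an order \<open>\<O>\<close>, integral units \<open>u\<^sub>1\<close>, \<open>u\<^sub>2\<close> and \<open>c\<close> in \<open>K\<close>, then \<open>c\<close> has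
  valuation \<open>0\<close>, so \<open>c\<O> = \<O>\<close> and \<open>u\<^sub>1\<O> = u\<^sub>2\<O>\<close>.
\<close>

lemma mem_elt_set_times_iff: "u \<noteq> 0 \<Longrightarrow> x \<in> u *o M \<longleftrightarrow> inverse u * x \<in> M"
  for u x :: "'a::field"
proof
  assume "u \<noteq> 0" "inverse u * x \<in> M"
  moreover from this have "x = u * (inverse u * x)"
    by (simp add: mult.assoc[symmetric])
  ultimately show "x \<in> u *o M"
    unfolding elt_set_times_def by blast
qed (auto simp: elt_set_times_def mult.assoc[symmetric])

section \<open>Valuations\<close>

context nonarch_local_field
begin

lemma val_one [simp]: "v 1 = 0"
  using val_mult[of 1 1] by simp

lemma val_inverse: "x \<noteq> 0 \<Longrightarrow> v (inverse x) = - v x"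
  using val_mult[of x "inverse x"] by simp

lemma val_minus [simp]: "v (- x) = v x"
proof (cases "x = 0")
  case False
  have "v (-1) = 0"
    using val_mult[of "-1" "-1"] by simp
  then show ?thesis
    using val_mult[of "-1" x] False by simp
qed simp

lemma val_power: "x \<noteq> 0 \<Longrightarrow> v (x ^ n) = int n * v x"
  by (induction n) (simp_all add: val_mult algebra_simps)

lemma val_ge_zero [simp]: "val_ge v N 0"
  by (simp add: val_ge_def)

lemma val_ge_one [simp]: "val_ge v 0 1"
  by (simp add: val_ge_def)

lemma val_ge_mono: "val_ge v N x \<Longrightarrow> M \<le> N \<Longrightarrow> val_ge v M x"
  by (auto simp: val_ge_def)

lemma val_ge_add: "val_ge v N x \<Longrightarrow> val_ge v N y \<Longrightarrow> val_ge v N (x + y)"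
  using val_add[of x y] unfolding val_ge_def by fastforce

lemma val_ge_minus [simp]: "val_ge v N (- x) \<longleftrightarrow> val_ge v N x"
  by (simp add: val_ge_def)

lemma val_ge_diff: "val_ge v N x \<Longrightarrow> val_ge v N y \<Longrightarrow> val_ge v N (x - y)"
  using val_ge_add[of N x "- y"] by simp

lemma val_ge_mult: "val_ge v M x \<Longrightarrow> val_ge v N y \<Longrightarrow> val_ge v (M + N) (x * y)"
  by (cases "x = 0"; cases "y = 0") (auto simp: val_ge_def val_mult)

lemma val_ge_0_mult: "val_ge v 0 x \<Longrightarrow> val_ge v 0 y \<Longrightarrow> val_ge v 0 (x * y)"
  using val_ge_mult[of 0 x 0 y] by simp

lemma val_ge_mult_left_iff: "x \<noteq> 0 \<Longrightarrow> val_ge v N (x * y) \<longleftrightarrow> val_ge v (N - v x) y"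
  by (cases "y = 0") (auto simp: val_ge_def val_mult)

text \<open>A nonzero element has a finite integer valuation, so only 0 is divisible by all powers
  of the maximal ideal. This makes limits unique.\<close>

lemma val_ge_all_imp_zero: "(\<And>N. val_ge v (int N) x) \<Longrightarrow> x = 0"
proof (rule ccontr)
  assume "\<And>N. val_ge v (int N) x" and "x \<noteq> 0"
  then have "int (nat (v x + 1)) \<le> v x"
    unfolding val_ge_def by blast
  then show False by linarith
qed

end

section \<open>Unramified quadratic extensions\<close>

context unramified_quadratic_extension
begin

lemma emb_zero [simp]: "emb 0 = 0"
  using emb_add[of 0 0] by simp

lemma emb_minus [simp]: "emb (- x) = - emb x"
  using emb_add[of x "- x"] by (simp add: eq_neg_iff_add_eq_0 add.commute)

lemma emb_diff: "emb (x - y) = emb x - emb y"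
  using emb_add[of x "- y"] by simp

lemma emb_eq_0_iff [simp]: "emb x = 0 \<longleftrightarrow> x = 0"
proof
  assume "emb x = 0"
  then show "x = 0"
    using emb_mult[of x "inverse x"] emb_one by (cases "x = 0") auto
qed simp

lemma emb_power: "emb (x ^ n) = emb x ^ n"
  by (induction n) (simp_all add: emb_mult emb_one)

lemma emb_inverse: "emb (inverse x) = inverse (emb x)"
proof (cases "x = 0")
  case False
  then have "emb x * emb (inverse x) = 1"
    using emb_mult[of x "inverse x"] emb_one by simp
  then show ?thesis
    by (simp add: inverse_unique)
qed simp

text \<open>Evaluating at a uniformizer shows that the factor \<open>e\<close> from
  \<open>val_extends\<close> is unique, so the definite description in
  \<open>ramification_index\<close> denotes it, and it equals 1.\<close>

lemma val_emb: "w (emb x) = v x" if "x \<noteq> 0"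
proof -
  obtain e where e: "\<And>x. x \<noteq> 0 \<Longrightarrow> w (emb x) = e * v x"
    using val_extends by blast
  obtain q where q: "q \<noteq> 0" "v q = 1"
    using K.ex_uniformizer by (auto simp: uniformizer_def)
  have "ramification_index v w emb = e"
    unfolding ramification_index_def
  proof (rule the_equality)
    fix e' assume "\<forall>x. x \<noteq> 0 \<longrightarrow> w (emb x) = e' * v x"
    then show "e' = e" using e[of q] q by simp
  qed (use e in blast)
  then show ?thesis
    using e that unramified by simp
qed

lemma val_ge_emb [simp]: "val_ge w N (emb x) \<longleftrightarrow> val_ge v N x"
  by (cases "x = 0") (simp_all add: val_ge_def val_emb)

sublocale VS: vector_space "emb_scale emb"
  by unfold_locales (auto simp: emb_add emb_mult emb_one algebra_simps)

text \<open>A surjective embedding would make \<open>{1}\<close> span \<open>L\<close> over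
  \<open>K\<close>, bounding the dimension by 1.\<close>

lemma range_emb_neq_UNIV: "range emb \<noteq> UNIV"
proof
  assume *: "range emb = UNIV"
  have "x \<in> VS.span {1}" for x
  proof -
    obtain a where "x = emb a" using * by blast
    then show ?thesis
      using VS.span_scale[OF VS.span_base[of 1 "{1}"], of a] by simp
  qed
  then have "VS.dim UNIV \<le> card {1 :: 'l}"
    by (intro VS.dim_le_card) auto
  then show False
    using degree_two by simp
qed

text \<open>An element outside \<open>K\<close> is independent of 1, and a third independent vector
  would exceed dimension 2, so 1 and \<Delta> form a \<open>K\<close>-basis of
  \<open>L\<close>.\<close>

lemma ex_affine_combination:
  assumes "\<Delta> \<notin> range emb"
  obtains a b where "x = emb a + emb b * \<Delta>"
proof -
  obtain B where B: "VS.independent B" "VS.span B = UNIV" "card B = 2"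
    using degree_two VS.basis_exists[of UNIV] by (metis UNIV_I VS.span_UNIV top.extremum_uniqueI)
  have "finite B"
    using B(3) card.infinite by fastforce
  have span1: "y \<in> VS.span {1} \<longleftrightarrow> y \<in> range emb" for y
    by (auto simp: VS.span_singleton)
  have "\<Delta> \<noteq> 1"
    using assms emb_one by (metis rangeI)
  have ind: "VS.independent {\<Delta>, 1}"
    using assms span1 by (intro VS.independent_insertI) (auto simp: VS.independent_empty)
  have "x \<in> VS.span {\<Delta>, 1}"
  proof (rule ccontr)
    assume x: "x \<notin> VS.span {\<Delta>, 1}"
    then have "VS.independent {x, \<Delta>, 1}"
      using ind by (rule VS.independent_insertI)
    then have "card {x, \<Delta>, 1} \<le> card B"
      using VS.independent_span_bound[OF \<open>finite B\<close>, of "{x, \<Delta>, 1}"] B by auto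
    moreover have "x \<noteq> \<Delta>" "x \<noteq> 1"
      using x VS.span_base by blast+
    ultimately show False
      using \<open>\<Delta> \<noteq> 1\<close> B by simp
  qed
  then obtain b where "x - emb b * \<Delta> \<in> VS.span {1}"
    by (auto simp: VS.span_insert[of \<Delta>])
  then obtain a where "x - emb b * \<Delta> = emb a"
    using span1 by blast
  then show ?thesis
    by (intro that[of a b]) (simp add: algebra_simps)
qed

end

section \<open>Coordinates of integral elements with respect to 1 and \<Delta>\<close>

locale unramified_quadratic_generator = unramified_quadratic_extension v w emb
  for v :: "'k::field_char_0 \<Rightarrow> int" and w :: "'l::field_char_0 \<Rightarrow> int" and emb :: "'k \<Rightarrow> 'l" +
  fixes p :: 'k and \<Delta> :: 'l
  assumes p_uniformizer: "uniformizer v p"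
    and val_ring_eq_adjoin: "val_ring w = adjoin (emb ` val_ring v) \<Delta>"
begin

lemma p_nonzero [simp]: "p \<noteq> 0" and val_p [simp]: "v p = 1"
  using p_uniformizer by (auto simp: uniformizer_def)

lemma val_emb_p_power [simp]: "w (emb p ^ n) = int n"
  by (simp add: L.val_power val_emb)

text \<open>Horner's scheme: a polynomial with constant term \<open>a\<close> evaluates to
  \<open>a + y * z\<close>, where \<open>z\<close> is the value of a polynomial of smaller length
  with coefficients in the same ring.\<close>

lemma adjoin_induct [consumes 1, case_names zero pCons]:
  assumes "x \<in> adjoin (emb ` val_ring v) y"
    and "P 0"
    and "\<And>a z. val_ge v 0 a \<Longrightarrow> P z \<Longrightarrow> P (emb a + y * z)"
  shows "P x"
proof -
  obtain f where f: "x = poly f y" "\<And>i. coeff f i \<in> emb ` val_ring v"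
    using assms(1) by (auto simp: adjoin_def)
  have "P (poly f y)"
    using f(2)
  proof (induction f)
    case (pCons c f)
    have "c \<in> emb ` val_ring v" "\<And>i. coeff f i \<in> emb ` val_ring v"
      using pCons.prems[of 0] pCons.prems[of "Suc _"] by auto
    then show ?case
      using pCons.IH assms(3) by (auto simp: val_ring_def)
  qed (simp add: assms)
  then show ?thesis by (simp add: f)
qed

lemma emb_zero_mem: "0 \<in> emb ` val_ring v"
  by (auto simp: val_ring_def intro!: image_eqI[of _ _ 0])

lemma affine_in_adjoin:
  assumes "val_ge v 0 a" "val_ge v 0 b"
  shows "emb a + emb b * y \<in> adjoin (emb ` val_ring v) y"
proof -
  have "coeff [:emb a, emb b:] i \<in> emb ` val_ring v" for i
    using assms emb_zero_mem by (auto simp: coeff_pCons val_ring_def split: nat.split)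
  moreover have "poly [:emb a, emb b:] y = emb a + emb b * y"
    by (simp add: mult.commute)
  ultimately show ?thesis
    unfolding adjoin_def by (smt (verit, best) mem_Collect_eq)
qed

lemma mem_adjoin_Delta_iff: "x \<in> adjoin (emb ` val_ring v) \<Delta> \<longleftrightarrow> val_ge w 0 x"
  unfolding val_ring_eq_adjoin[symmetric] by (simp add: val_ring_def)

lemma val_ge_Delta [simp]: "val_ge w 0 \<Delta>"
  using affine_in_adjoin[of 0 1 \<Delta>] by (simp add: emb_one mem_adjoin_Delta_iff)

lemma integral_multiple:
  obtains k where "val_ge w 0 (emb p ^ k * x)"
proof (cases "x = 0")
  case False
  \<comment> \<open>As \<open>emb p\<close> has valuation 1 in \<open>L\<close>, this power cancels
    a negative valuation; for integral \<open>x\<close>, \<open>nat\<close> truncates the exponent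
    to 0.\<close>
  then have "val_ge w 0 (emb p ^ nat (- w x) * x)"
    by (simp add: L.val_ge_mult_left_iff) (simp add: val_ge_def)
  then show ?thesis by (rule that)
qed (use that in simp)

text \<open>If \<Delta> were in \<open>K\<close>, Horner induction would put all integral elements
  of \<open>L\<close> in \<open>K\<close>; clearing denominators by powers of \<open>p\<close> would
  give \<open>L = K\<close>.\<close>

lemma Delta_notin_range: "\<Delta> \<notin> range emb"
proof
  assume "\<Delta> \<in> range emb"
  then obtain c where c: "\<Delta> = emb c" by blast
  have "x \<in> range emb" for x
  proof -
    obtain k where "val_ge w 0 (emb p ^ k * x)"
      by (rule integral_multiple)
    then have "emb p ^ k * x \<in> adjoin (emb ` val_ring v) \<Delta>"
      by (simp add: mem_adjoin_Delta_iff)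
    then have "emb p ^ k * x \<in> range emb"
    proof (induction rule: adjoin_induct)
      case (pCons a z)
      then obtain b where "z = emb b" by blast
      then have "emb a + \<Delta> * z = emb (a + c * b)"
        by (simp add: c emb_add emb_mult)
      then show ?case by simp
    qed (metis emb_zero rangeI)
    then obtain a where "emb p ^ k * x = emb a" by blast
    then have "x = emb (inverse (p ^ k) * a)"
      unfolding emb_mult emb_inverse emb_power by (simp add: field_simps)
    then show ?thesis by blast
  qed
  then show False
    using range_emb_neq_UNIV by blast
qed

lemma affine_eq_0_iff: "emb a + emb b * \<Delta> = 0 \<longleftrightarrow> a = 0 \<and> b = 0"
proof
  assume *: "emb a + emb b * \<Delta> = 0"
  have "b = 0"
  proof (rule ccontr)
    assume "b \<noteq> 0"
    then have "\<Delta> = emb (- a * inverse b)"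
      using * by (simp only: emb_mult emb_inverse emb_minus)
        (simp add: field_simps eq_neg_iff_add_eq_0)
    then show False
      using Delta_notin_range by blast
  qed
  then show "a = 0 \<and> b = 0"
    using * by simp
qed simp

lemma Delta_not_congruent: "\<not> val_ge w 1 (\<Delta> - emb c)" if c: "val_ge v 0 c"
proof
  assume Dc: "val_ge w 1 (\<Delta> - emb c)"
  \<comment> \<open>The residue fields would coincide: in Horner's scheme \<Delta> may be replaced
    by \<open>c\<close> modulo the maximal ideal.\<close>
  have step: "\<exists>a. val_ge v 0 a \<and> val_ge w 1 (x - emb a)" if "val_ge w 0 x" for x
  proof -
    have "x \<in> adjoin (emb ` val_ring v) \<Delta>"
      using that by (simp add: mem_adjoin_Delta_iff)
    then show ?thesis
    proof (induction rule: adjoin_induct)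
      case (pCons a z)
      then obtain b where b: "val_ge v 0 b" "val_ge w 1 (z - emb b)" by blast
      have "(emb a + \<Delta> * z) - emb (a + c * b) = \<Delta> * (z - emb b) + (\<Delta> - emb c) * emb b"
        by (simp add: emb_add emb_mult algebra_simps)
      moreover have "val_ge w 1 (\<Delta> * (z - emb b))" "val_ge w 1 ((\<Delta> - emb c) * emb b)"
        using L.val_ge_mult[OF val_ge_Delta b(2)] L.val_ge_mult[OF Dc, of 0 "emb b"] b(1)
        by simp_all
      moreover have "val_ge v 0 (a + c * b)"
        using pCons K.val_ge_add K.val_ge_mult[OF c b(1)] by simp
      ultimately show ?case
        by (metis L.val_ge_add)
    qed (auto intro: exI[of _ 0])
  qed
  \<comment> \<open>Successive approximation: the error divided by \<open>p ^ N\<close> is integral,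
    so \<open>step\<close> supplies the next digit \<open>b\<close> of a \<open>p\<close>-adic
    expansion of \<Delta> with digits from \<open>K\<close>.\<close>
  have approx: "\<exists>a. val_ge w (int N) (\<Delta> - emb a)" for N
  proof (induction N)
    case 0
    show ?case by (rule exI[of _ 0]) simp
  next
    case (Suc N)
    then obtain a where a: "val_ge w (int N) (\<Delta> - emb a)" by blast
    define y where "y = inverse (emb p ^ N) * (\<Delta> - emb a)"
    have y: "\<Delta> - emb a = emb p ^ N * y"
      by (simp add: y_def)
    have "val_ge w 0 y"
      using a unfolding y by (simp add: L.val_ge_mult_left_iff)
    then obtain b where b: "val_ge w 1 (y - emb b)"
      using step by blast
    have "\<Delta> - emb (a + p ^ N * b) = emb p ^ N * (y - emb b)"
      using y by (simp add: emb_add emb_mult emb_power algebra_simps)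
    moreover have "val_ge w (int (Suc N)) (emb p ^ N * (y - emb b))"
      using b by (simp add: L.val_ge_mult_left_iff)
    ultimately show ?case by metis
  qed
  then obtain X where X: "\<And>N. val_ge w (int N) (\<Delta> - emb (X N))" by metis
  have X': "val_ge w N (\<Delta> - emb (X i))" if "nat N \<le> i" for N i
    by (rule L.val_ge_mono[OF X[of i]]) (use that in linarith)
  \<comment> \<open>The difference of two errors is the image of \<open>X i - X j\<close>, and the
    embedding preserves valuations; hence the sequence is Cauchy already in
    \<open>K\<close>.\<close>
  have "val_Cauchy v X"
    unfolding val_Cauchy_def
  proof (intro allI exI impI)
    fix N i j assume "nat N \<le> i" "nat N \<le> j"
    then have "val_ge w N ((\<Delta> - emb (X j)) - (\<Delta> - emb (X i)))"
      by (intro L.val_ge_diff X')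
    moreover have "(\<Delta> - emb (X j)) - (\<Delta> - emb (X i)) = emb (X i - X j)"
      by (simp add: emb_diff)
    ultimately show "val_ge v N (X i - X j)"
      by simp
  qed
  then obtain l where l: "val_tendsto v X l"
    using K.complete by blast
  have "\<Delta> - emb l = 0"
  proof (rule L.val_ge_all_imp_zero)
    fix N
    obtain M where M: "\<And>i. i \<ge> M \<Longrightarrow> val_ge v (int N) (X i - l)"
      using l unfolding val_tendsto_def by blast
    \<comment> \<open>One index large enough for both estimates: \<open>X i\<close> is close to
      \<Delta> in \<open>L\<close> and to \<open>l\<close> in \<open>K\<close>.\<close>
    define i where "i = max M N"
    have "val_ge w (int N) ((\<Delta> - emb (X i)) + emb (X i - l))"
      using M[of i] by (intro L.val_ge_add X') (auto simp: i_def)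
    then show "val_ge w (int N) (\<Delta> - emb l)"
      by (simp add: emb_diff)
  qed
  then show False
    using Delta_notin_range by (metis eq_iff_diff_eq_0 rangeI)
qed

lemma integral_affine_iff:
  "val_ge w 0 (emb a + emb b * \<Delta>) \<longleftrightarrow> val_ge v 0 a \<and> val_ge v 0 b"
proof
  assume *: "val_ge w 0 (emb a + emb b * \<Delta>)"
  have "val_ge v 0 b"
  proof (rule ccontr)
    assume "\<not> val_ge v 0 b"
    then have b: "b \<noteq> 0" "v b < 0" by (auto simp: val_ge_def)
    \<comment> \<open>Chosen so that \<open>emb a + emb b * \<Delta>\<close> factors as
      \<open>emb b * (\<Delta> - emb c)\<close>; the negative valuation of \<open>b\<close> then
      forces the second factor into the maximal ideal.\<close>
    define c where "c = - (a * inverse b)"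
    have "emb b * (\<Delta> - emb c) = emb a + emb b * \<Delta>"
      unfolding c_def emb_minus emb_mult emb_inverse using b by (simp add: field_simps)
    with * have "val_ge w 0 (emb b * (\<Delta> - emb c))" by simp
    then have "val_ge w (- v b) (\<Delta> - emb c)"
      using b by (simp add: L.val_ge_mult_left_iff val_emb)
    then have Dc: "val_ge w 1 (\<Delta> - emb c)"
      by (rule L.val_ge_mono) (use b in simp)
    \<comment> \<open>\<open>emb c\<close> is a difference of integral elements, so \<open>c\<close>
      is integral, as \<open>Delta_not_congruent\<close> requires.\<close>
    then have "val_ge w 0 (\<Delta> - (\<Delta> - emb c))"
      by (intro L.val_ge_diff val_ge_Delta L.val_ge_mono[OF Dc]) auto
    then show False
      using Delta_not_congruent Dc by simp
  qed
  moreover from this have "val_ge w 0 (emb b * \<Delta>)"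
    using L.val_ge_mult[of 0 "emb b" 0 \<Delta>] by simp
  with * have "val_ge w 0 ((emb a + emb b * \<Delta>) - emb b * \<Delta>)"
    by (rule L.val_ge_diff)
  ultimately show "val_ge v 0 a \<and> val_ge v 0 b"
    by simp
next
  assume "val_ge v 0 a \<and> val_ge v 0 b"
  then show "val_ge w 0 (emb a + emb b * \<Delta>)"
    using L.val_ge_add L.val_ge_mult[of 0 "emb b" 0 \<Delta>] by simp
qed

section \<open>Orders and their lattices\<close>

abbreviation ord :: "nat \<Rightarrow> 'l set" where
  "ord m \<equiv> quad_order v emb p \<Delta> m"

text \<open>\<Delta> satisfies a monic quadratic equation over \<open>K\<close>, whose coefficients
  are integral by \<open>integral_affine_iff\<close> because the square of \<Delta> is. Higher
  powers of the generator therefore reduce to two terms.\<close>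

lemma quad_order_eq:
  "ord m = {emb a + emb b * (emb p ^ m * \<Delta>) | a b. val_ge v 0 a \<and> val_ge v 0 b}"
    (is "_ = ?S")
proof (intro set_eqI iffI)
  obtain s t where st: "\<Delta> * \<Delta> = emb s + emb t * \<Delta>"
    using ex_affine_combination[OF Delta_notin_range] by blast
  have "val_ge w 0 (\<Delta> * \<Delta>)"
    using L.val_ge_mult[of 0 \<Delta> 0 \<Delta>] by simp
  then have vst: "val_ge v 0 s" "val_ge v 0 t"
    unfolding st integral_affine_iff by auto
  have vp: "val_ge v 0 (p ^ m)"
    by (simp add: val_ge_def K.val_power)
  fix x assume "x \<in> ord m"
  then have "x \<in> adjoin (emb ` val_ring v) (emb p ^ m * \<Delta>)"
    by (simp add: quad_order_def)
  then show "x \<in> ?S"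
  proof (induction rule: adjoin_induct)
    case (pCons a z)
    then obtain b c where z: "z = emb b + emb c * (emb p ^ m * \<Delta>)"
      and bc: "val_ge v 0 b" "val_ge v 0 c" by blast
    have "emb a + emb p ^ m * \<Delta> * z =
        emb a + emb b * (emb p ^ m * \<Delta>) + emb c * emb p ^ m * emb p ^ m * (\<Delta> * \<Delta>)"
      by (simp add: z algebra_simps)
    \<comment> \<open>Of the two factors \<open>p ^ m\<close> in front of
      \<open>\<Delta> * \<Delta>\<close>, one is absorbed into the generator in the linear term,
      leaving an integral coefficient.\<close>
    also have "\<dots> = emb (a + c * p ^ m * p ^ m * s) + emb (b + c * p ^ m * t) * (emb p ^ m * \<Delta>)"
      unfolding st emb_add emb_mult emb_power by (simp add: algebra_simps)
    finally have "emb a + emb p ^ m * \<Delta> * z =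
      emb (a + c * p ^ m * p ^ m * s) + emb (b + c * p ^ m * t) * (emb p ^ m * \<Delta>)" .
    moreover have "val_ge v 0 (a + c * p ^ m * p ^ m * s)" "val_ge v 0 (b + c * p ^ m * t)"
      using pCons(1) bc vst vp
      by (simp_all add: K.val_ge_add K.val_ge_0_mult)
    ultimately show ?case by blast
  qed (auto intro!: exI[of _ 0])
next
  fix x assume "x \<in> ?S"
  then show "x \<in> ord m"
    using affine_in_adjoin by (auto simp: quad_order_def)
qed

lemma quad_order_integral: "x \<in> ord m \<Longrightarrow> val_ge w 0 x"
proof -
  assume "x \<in> ord m"
  then obtain a b where x: "x = emb a + emb (b * p ^ m) * \<Delta>" "val_ge v 0 a" "val_ge v 0 b"
    by (auto simp: quad_order_eq emb_mult emb_power mult.assoc)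
  moreover have "val_ge v 0 (b * p ^ m)"
    using K.val_ge_mult[of 0 b 0 "p ^ m"] x(3) by (simp add: val_ge_def K.val_power)
  ultimately show ?thesis
    by (simp add: integral_affine_iff)
qed

lemma emb_in_quad_order: "val_ge v 0 a \<Longrightarrow> emb a \<in> ord m"
  unfolding quad_order_eq by (rule CollectI, rule exI[of _ a], rule exI[of _ 0]) simp

lemma one_in_quad_order: "1 \<in> ord m"
  using emb_in_quad_order[of 1 m] by (simp add: emb_one)

text \<open>Multiplication by the generator shifts polynomial coefficients (\<open>D\<close>), while
  scaling (\<open>S\<close>) and addition (\<open>A\<close>) are read off the two-term form; writing
  \<open>x\<close> in that form combines the three.\<close>

lemma quad_order_mult: "x \<in> ord m \<Longrightarrow> y \<in> ord m \<Longrightarrow> x * y \<in> ord m"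
proof -
  assume x: "x \<in> ord m" and y: "y \<in> ord m"
  have D: "emb p ^ m * \<Delta> * z \<in> ord m" if z: "z \<in> ord m" for z
  proof -
    obtain f where f: "z = poly f (emb p ^ m * \<Delta>)" "\<And>i. coeff f i \<in> emb ` val_ring v"
      using z unfolding quad_order_def adjoin_def by blast
    have "coeff (pCons 0 f) i \<in> emb ` val_ring v" for i
      using f(2) emb_zero_mem by (auto simp: coeff_pCons split: nat.split)
    moreover have "emb p ^ m * \<Delta> * z = poly (pCons 0 f) (emb p ^ m * \<Delta>)"
      by (simp add: f)
    ultimately show ?thesis
      unfolding quad_order_def adjoin_def by blast
  qed
  have S: "emb a * z \<in> ord m" if a: "val_ge v 0 a" and z: "z \<in> ord m" for a z
  proof -
    obtain b c where bc: "z = emb b + emb c * (emb p ^ m * \<Delta>)" "val_ge v 0 b" "val_ge v 0 c"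
      using z by (auto simp: quad_order_eq)
    have "emb a * z = emb (a * b) + emb (a * c) * (emb p ^ m * \<Delta>)"
      unfolding bc(1) emb_mult by (simp add: algebra_simps)
    then show ?thesis
      using a bc(2,3) K.val_ge_0_mult
      unfolding quad_order_eq by blast
  qed
  have A: "z + z' \<in> ord m" if z: "z \<in> ord m" "z' \<in> ord m" for z z'
  proof -
    obtain b c b' c' where bc: "z = emb b + emb c * (emb p ^ m * \<Delta>)" "val_ge v 0 b" "val_ge v 0 c"
      "z' = emb b' + emb c' * (emb p ^ m * \<Delta>)" "val_ge v 0 b'" "val_ge v 0 c'"
      using z by (auto simp: quad_order_eq)
    have "z + z' = emb (b + b') + emb (c + c') * (emb p ^ m * \<Delta>)"
      unfolding bc(1,4) emb_add by (simp add: algebra_simps)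
    then show ?thesis
      using bc(2,3,5,6) K.val_ge_add unfolding quad_order_eq by blast
  qed
  obtain a b where x': "x = emb a + emb b * (emb p ^ m * \<Delta>)" "val_ge v 0 a" "val_ge v 0 b"
    using x by (auto simp: quad_order_eq)
  have "x * y = emb a * y + emb b * (emb p ^ m * \<Delta> * y)"
    unfolding x'(1) by (simp add: algebra_simps)
  then show ?thesis
    using A S D x' y by simp
qed

section \<open>Units of the orders\<close>

lemma ring_units_quad_order_iff:
  "x \<in> ring_units (ord m) \<longleftrightarrow> x \<noteq> 0 \<and> x \<in> ord m \<and> inverse x \<in> ord m"
proof
  assume "x \<in> ring_units (ord m)"
  then obtain y where "x \<in> ord m" "y \<in> ord m" "x * y = 1"
    by (auto simp: ring_units_def)
  then show "x \<noteq> 0 \<and> x \<in> ord m \<and> inverse x \<in> ord m"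
    using inverse_unique[of x y] by auto
next
  assume "x \<noteq> 0 \<and> x \<in> ord m \<and> inverse x \<in> ord m"
  then show "x \<in> ring_units (ord m)"
    unfolding ring_units_def using right_inverse by blast
qed

text \<open>A unit and its inverse are both integral, and their valuations are opposite.\<close>

lemma val_unit: "x \<in> ring_units (ord m) \<Longrightarrow> w x = 0"
  using quad_order_integral[of x m] quad_order_integral[of "inverse x" m] L.val_inverse[of x]
  by (simp add: ring_units_quad_order_iff val_ge_def)

lemma unit_mult_in_quad_order_iff:
  assumes "x \<in> ring_units (ord m)"
  shows "x * y \<in> ord m \<longleftrightarrow> y \<in> ord m"
proof
  assume "x * y \<in> ord m"
  then have "inverse x * (x * y) \<in> ord m"
    using assms quad_order_mult ring_units_quad_order_iff by blast
  then show "y \<in> ord m"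
    using assms by (simp add: ring_units_quad_order_iff mult.assoc[symmetric])
qed (use assms quad_order_mult ring_units_quad_order_iff in blast)

lemma unit_elt_set_times:
  assumes "x \<in> ring_units (ord m)"
  shows "x *o ord m = ord m"
proof -
  have "x \<noteq> 0" "inverse x \<in> ring_units (ord m)"
    using assms by (auto simp: ring_units_quad_order_iff)
  then show ?thesis
    by (auto simp: mem_elt_set_times_iff unit_mult_in_quad_order_iff)
qed

lemma ring_units_elt_set_times:
  assumes "x \<in> ring_units (ord m)"
  shows "x *o ring_units (ord m) = ring_units (ord m)"
proof -
  have "x \<noteq> 0" and inv: "inverse x \<in> ring_units (ord m)"
    using assms by (auto simp: ring_units_quad_order_iff)
  then have "inverse x * y \<in> ring_units (ord m) \<longleftrightarrow> y \<in> ring_units (ord m)" for y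
    \<comment> \<open>Being a unit concerns an element and its inverse; the first instance treats
      the inverse of \<open>inverse x * y\<close>, the second the product itself.\<close>
    using unit_mult_in_quad_order_iff[OF assms, of "inverse y"]
      unit_mult_in_quad_order_iff[OF inv, of y]
    by (auto simp: ring_units_quad_order_iff[of _ m] mult.commute)
  then show ?thesis
    using \<open>x \<noteq> 0\<close> by (intro set_eqI) (simp add: mem_elt_set_times_iff)
qed

section \<open>Lattices and homothety classes\<close>

lemma lattice_of_quad_order:
  assumes "u \<noteq> 0"
  shows "u *o ord m \<in> lattices v emb"
proof -
  \<comment> \<open>\<open>u\<close> and \<open>g\<close> are the images under multiplication by
    \<open>u\<close> of the basis 1, \<open>emb p ^ m * \<Delta>\<close> of the order. They must be
    distinct for the sum over \<open>{u, g}\<close> to have two terms.\<close>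
  define g where "g = u * (emb p ^ m * \<Delta>)"
  have "emb p ^ m * \<Delta> \<noteq> 1"
    using affine_eq_0_iff[of "-1" "p ^ m"] by (auto simp: emb_one emb_power)
  then have "u \<noteq> g"
    using assms by (auto simp: g_def)
  have M: "u *o ord m = {emb a * u + emb b * g | a b. val_ge v 0 a \<and> val_ge v 0 b}" (is "_ = ?M")
  proof -
    have "u * (emb a + emb b * (emb p ^ m * \<Delta>)) = emb a * u + emb b * g" for a b
      by (simp add: g_def algebra_simps)
    then show ?thesis
      unfolding elt_set_times_def quad_order_eq by auto metis+
  qed
  have "?M = {\<Sum>b\<in>{u, g}. emb (c b) * b | c. \<forall>b\<in>{u, g}. c b \<in> val_ring v}" (is "_ = ?N")
  proof (intro equalityI subsetI)
    fix x assume "x \<in> ?M"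
    then obtain a b where "x = emb a * u + emb b * g" "val_ge v 0 a" "val_ge v 0 b" by blast
    then show "x \<in> ?N"
      using \<open>u \<noteq> g\<close>
      by (auto simp: val_ring_def intro!: exI[of _ "\<lambda>y. if y = u then a else b"])
  next
    fix x assume "x \<in> ?N"
    then show "x \<in> ?M"
      using \<open>u \<noteq> g\<close> by (auto simp: val_ring_def)
  qed
  moreover have "VS.span (u *o ord m) = UNIV"
  proof -
    have "x \<in> VS.span (u *o ord m)" for x
    proof -
      obtain a b where ab: "inverse u * x = emb a + emb b * \<Delta>"
        using ex_affine_combination[OF Delta_notin_range] by blast
      have "u \<in> u *o ord m"
        using assms one_in_quad_order by (simp add: mem_elt_set_times_iff)
      moreover have "g \<in> u *o ord m"
        unfolding M by (rule CollectI, rule exI[of _ 0], rule exI[of _ 1]) (simp add: emb_one)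
      \<comment> \<open>Over \<open>K\<close> the factor \<open>p ^ m\<close> is invertible, so
        \<Delta> itself is recovered from the generator of the order.\<close>
      ultimately have "emb a * u + emb (b * inverse (p ^ m)) * g \<in> VS.span (u *o ord m)"
        by (intro VS.span_add VS.span_scale VS.span_base)
      moreover have "emb a * u + emb (b * inverse (p ^ m)) * g = u * (inverse u * x)"
        unfolding ab g_def emb_mult emb_inverse emb_power by (simp add: field_simps)
      ultimately show ?thesis
        using assms by (simp add: mult.assoc[symmetric])
    qed
    then show ?thesis by blast
  qed
  ultimately show ?thesis
    unfolding lattices_def using M by (auto intro!: exI[of _ "{u, g}"])
qed

text \<open>A homothety by \<open>c\<close> makes \<open>emb c * u1 * inverse u2\<close> a unit of
  \<open>ord n\<close>. As \<open>u1\<close> and \<open>u2\<close> have valuation 0, so has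
  \<open>c\<close>; then \<open>emb c\<close> is a unit of \<open>ord n\<close> and can be
  cancelled.\<close>

lemma vertex_of_eq_iff:
  assumes u1: "u1 \<in> ring_units (ord m)" and u2: "u2 \<in> ring_units (ord m)"
  shows "vertex_of v emb (u1 *o ord n) = vertex_of v emb (u2 *o ord n)
    \<longleftrightarrow> u1 * inverse u2 \<in> ring_units (ord n)"
proof
  have nz: "u1 \<noteq> 0" "u2 \<noteq> 0"
    using assms by (auto simp: ring_units_quad_order_iff)
  have w0: "w u1 = 0" "w u2 = 0"
    using assms val_unit by auto
  {
    assume eq: "vertex_of v emb (u1 *o ord n) = vertex_of v emb (u2 *o ord n)"
    \<comment> \<open>Reflexivity of homothety, with scalar 1, puts the lattice in its own
      class.\<close>
    have "u2 *o ord n = emb 1 *o (u2 *o ord n)"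
      by (simp add: emb_one)
    moreover have "(1 :: 'k) \<noteq> 0" by simp
    ultimately have "u2 *o ord n \<in> vertex_of v emb (u2 *o ord n)"
      using lattice_of_quad_order[OF nz(2)] unfolding vertex_of_def homothety_def Image_singleton
        mem_Collect_eq case_prod_conv by blast
    then have "u2 *o ord n \<in> vertex_of v emb (u1 *o ord n)"
      by (simp add: eq)
    then obtain c where c: "c \<noteq> 0" and hom: "u2 *o ord n = emb c *o (u1 *o ord n)"
      unfolding vertex_of_def homothety_def by blast
    define t where "t = emb c * u1 * inverse u2"
    have t0: "t \<noteq> 0" using c nz by (simp add: t_def)
    have mem: "x \<in> u2 *o ord n \<longleftrightarrow> inverse (emb c * u1) * x \<in> ord n" for x
      unfolding hom using c nz by (simp add: set_times_rearrange2 mem_elt_set_times_iff)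
    \<comment> \<open>Since 1 lies in the order, both \<open>emb c * u1\<close> and
      \<open>u2\<close> lie in the common lattice; expressing each through the other description
      shows that \<open>t\<close> and its inverse are in \<open>ord n\<close>.\<close>
    have "inverse u2 * (emb c * u1) \<in> ord n"
      using mem[of "emb c * u1"] nz left_inverse[of "emb c * u1"] c one_in_quad_order[of n]
      by (simp add: mem_elt_set_times_iff del: left_inverse)
    moreover have "inverse (emb c * u1) * u2 \<in> ord n"
      using mem[of u2] nz one_in_quad_order by (simp add: mem_elt_set_times_iff)
    ultimately have t: "t \<in> ring_units (ord n)"
      using t0 by (simp add: ring_units_quad_order_iff t_def mult_ac)
    have "w t = v c"
      using c nz w0 by (simp add: t_def L.val_mult L.val_inverse val_emb)
    then have "v c = 0"
      using val_unit[OF t] by simp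
    then have "emb c \<in> ring_units (ord n)"
      using c emb_in_quad_order[of c n] emb_in_quad_order[of "inverse c" n]
      by (simp add: ring_units_quad_order_iff val_ge_def K.val_inverse emb_inverse)
    then have "inverse (emb c) \<in> ring_units (ord n)"
      by (simp add: ring_units_quad_order_iff)
    then have "inverse (emb c) * t \<in> ring_units (ord n)"
      using ring_units_elt_set_times t unfolding elt_set_times_def by blast
    then show "u1 * inverse u2 \<in> ring_units (ord n)"
      using c by (simp add: t_def mult.assoc[symmetric])
  }
  assume "u1 * inverse u2 \<in> ring_units (ord n)"
  \<comment> \<open>For the converse, the quotient fixes \<open>ord n\<close>; multiplying by
    \<open>u2\<close> shows that the two lattices are even equal.\<close>
  then have "u2 *o ((u1 * inverse u2) *o ord n) = u2 *o ord n"
    by (simp add: unit_elt_set_times)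
  then have "u1 *o ord n = u2 *o ord n"
    using nz by (simp add: set_times_rearrange2 mult.left_commute)
  then show "vertex_of v emb (u1 *o ord n) = vertex_of v emb (u2 *o ord n)"
    by simp
qed

lemma vertex_of_in_tree_vertices: "M \<in> lattices v emb \<Longrightarrow> vertex_of v emb M \<in> tree_vertices v emb"
  unfolding vertex_of_def tree_vertices_def by (rule quotientI)

text \<open>Equal vertices force equal cosets of the unit group of \<open>ord n\<close>, and a
  system of representatives meets each coset only once.\<close>

lemma inj_on_vertex_of_coset_reps:
  assumes "coset_reps (ring_units (ord m)) (ring_units (ord n)) l u"
  shows "inj_on (\<lambda>i. vertex_of v emb (u i *o ord n)) {1..l}"
proof (rule inj_onI)
  fix i j assume ij: "i \<in> {1..l}" "j \<in> {1..l}"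
    and eq: "vertex_of v emb (u i *o ord n) = vertex_of v emb (u j *o ord n)"
  have u: "u i \<in> ring_units (ord m)" "u j \<in> ring_units (ord m)"
    and inj: "inj_on (\<lambda>i. u i *o ring_units (ord n)) {1..l}"
    using assms ij by (auto simp: coset_reps_def bij_betw_def)
  have nz: "u j \<noteq> 0"
    using u(2) by (simp add: ring_units_quad_order_iff)
  have "u i * inverse (u j) \<in> ring_units (ord n)"
    using eq vertex_of_eq_iff u by blast
  then have "u j *o ((u i * inverse (u j)) *o ring_units (ord n)) = u j *o ring_units (ord n)"
    by (simp add: ring_units_elt_set_times)
  then have "u i *o ring_units (ord n) = u j *o ring_units (ord n)"
    using nz by (simp add: set_times_rearrange2 mult.left_commute)
  then show "i = j"
    using inj ij by (auto dest: inj_onD)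
qed

end

theorem theorem5p24:
  fixes v :: "'k::field_char_0 \<Rightarrow> int" and w :: "'l::field_char_0 \<Rightarrow> int"
    and emb :: "'k \<Rightarrow> 'l" and p :: 'k and \<Delta> :: 'l and n d :: nat
  assumes "unramified_quadratic_extension v w emb"
    and "uniformizer v p"
    and "val_ring w = adjoin (emb ` val_ring v) \<Delta>"
    and "n \<ge> 1" and "d < n"
  shows "(\<forall>u1 \<in> ring_units (quad_order v emb p \<Delta> (n - d)).
          \<forall>u2 \<in> ring_units (quad_order v emb p \<Delta> (n - d)).
            u1 *o quad_order v emb p \<Delta> n \<in> lattices v emb \<and>
            u2 *o quad_order v emb p \<Delta> n \<in> lattices v emb \<and>
            (vertex_of v emb (u1 *o quad_order v emb p \<Delta> n) =
               vertex_of v emb (u2 *o quad_order v emb p \<Delta> n)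
             \<longleftrightarrow> u1 * inverse u2 \<in> ring_units (quad_order v emb p \<Delta> n))) \<and>
         (\<forall>l u. coset_reps (ring_units (quad_order v emb p \<Delta> (n - d)))
                  (ring_units (quad_order v emb p \<Delta> n)) l u \<longrightarrow>
            (\<forall>i\<in>{1..l}. vertex_of v emb (u i *o quad_order v emb p \<Delta> n) \<in> tree_vertices v emb) \<and>
            inj_on (\<lambda>i. vertex_of v emb (u i *o quad_order v emb p \<Delta> n)) {1..l})"
proof -
  interpret unramified_quadratic_generator v w emb p \<Delta>
    using assms by (simp add: unramified_quadratic_generator_def
        unramified_quadratic_generator_axioms_def)
  have lat: "u *o ord n \<in> lattices v emb" if "u \<in> ring_units (ord (n - d))" for u
    using that lattice_of_quad_order by (simp add: ring_units_quad_order_iff)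
  then have "vertex_of v emb (u i *o ord n) \<in> tree_vertices v emb"
    if "coset_reps (ring_units (ord (n - d))) (ring_units (ord n)) l u" "i \<in> {1..l}" for l u i
    using that by (intro vertex_of_in_tree_vertices) (simp add: coset_reps_def)
  \<comment> \<open>The results on units of \<open>ord m\<close> are applied with
    \<open>m = n - d\<close>.\<close>
  then show ?thesis
    using lat vertex_of_eq_iff inj_on_vertex_of_coset_reps by blast
qed

end
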